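(* Let $n\ge1$ and let $H\in\mathbb{R}^{n\times n}$ be symmetric positive definite. The set $\Omega_{\rm BB}(H)\subset\mathbb{R}^n\times\mathbb{R}^n$ is a closed cone. For every fixed positive spectral weight $W=\omega(H)$, the transition $T_W$ maps $\Omega_{\rm BB}(H)$ into $\Omega_{\rm BB}(H)$, is continuous on $\Omega_{\rm BB}(H)$ (including at the origin), and is positively homogeneous of degree one, i.e. $T_W(tz)=tT_W(z)$ for all $t\ge0$ and $z\in\Omega_{\rm BB}(H)$.
   Context: A closed cone is a nonempty closed set that contains $0$ and is stable under multiplication by every $t\ge 0$. Let $a:=\lambda_{\min}(H)>0$ and $b:=\lambda_{\max}(H)$ be the smallest and largest eigenvalues of $H$. A positive spectral weight is a matrix $W=\omega(H)$ (functional calculus), where $\omega$ is a real function on the spectrum $\sigma(H)$ with $\omega(\lambda)>0$ for every $\lambda\in\sigma(H)$; thus $W$ is symmetric positive definite and $WH=HW$. For $u\in\mathbb{R}^n\setminus\{0\}$ set $\alpha_W(u):=\dfrac{u^TWu}{u^TWHu}$, which lies in $[b^{-1},a^{-1}]$. The compatible cone is $$\Omega_{\rm BB}(H):=\{(u,v)\in\mathbb{R}^n\times\mathbb{R}^n: v=(I-\alpha H)u\text{ for some }\alpha\in[b^{-1},a^{-1}]\}.$$ Its only element with $u=0$ is $(0,0)$. On $\Omega_{\rm BB}(H)$ define $T_W(u,v):=\bigl(v,(I-\alpha_W(u)H)v\bigr)$ if $u\ne 0$, and $T_W(0,0):=(0,0)$. The product space carries the norm $\lVert(u,v)\rVert_\times:=(\lVert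 u\rVert^2+\lVert v\rVert^2)^{1/2}$ with $\lVert\cdot\rVert$ Euclidean. *)

theory Defs
  imports "HOL-Analysis.Analysis"
begin

definition sym_pos_def :: "real^'n^'n \<Rightarrow> bool" where
  "sym_pos_def H \<longleftrightarrow> transpose H = H \<and> (\<forall>x. x \<noteq> 0 \<longrightarrow> x \<bullet> (H *v x) > 0)"

definition eigenspace :: "real^'n^'n \<Rightarrow> real \<Rightarrow> (real^'n) set" where
  "eigenspace H l = {x. H *v x = l *\<^sub>R x}"

text \<open>Only real eigenvalues are collected; for symmetric matrices this is the whole spectrum.\<close>

definition spectrum :: "real^'n^'n \<Rightarrow> real set" where
  "spectrum H = {l. \<exists>x. x \<noteq> 0 \<and> x \<in> eigenspace H l}"

definition lambda_min :: "real^'n^'n \<Rightarrow> real" where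
  "lambda_min H = Min (spectrum H)"

definition lambda_max :: "real^'n^'n \<Rightarrow> real" where
  "lambda_max H = Max (spectrum H)"

text \<open>Functional calculus of a symmetric matrix through its spectral decomposition:
  \<open>\<omega>(H)\<close> is the sum of \<open>\<omega>(l) P\<^sub>l\<close> over the eigenvalues \<open>l\<close>, where \<open>P\<^sub>l\<close> is the
  orthogonal projection onto the eigenspace of \<open>l\<close> (the nearest-point map of that subspace).
  The values of \<open>\<omega>\<close> outside the spectrum are irrelevant.\<close>

definition functional_calculus :: "(real \<Rightarrow> real) \<Rightarrow> real^'n^'n \<Rightarrow> real^'n^'n" where
  "functional_calculus \<omega> H =
     (\<Sum>l\<in>spectrum H. \<omega> l *\<^sub>R matrix (closest_point (eigenspace H l)))"

definition positive_spectral_weight :: "real^'n^'n \<Rightarrow> real^'n^'n \<Rightarrow> bool" where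
  "positive_spectral_weight H W \<longleftrightarrow>
     (\<exists>\<omega>. (\<forall>l\<in>spectrum H. \<omega> l > 0) \<and> W = functional_calculus \<omega> H)"

definition closed_cone :: "'a::real_normed_vector set \<Rightarrow> bool" where
  "closed_cone S \<longleftrightarrow> S \<noteq> {} \<and> closed S \<and> 0 \<in> S \<and> cone S"

definition BB_alpha :: "real^'n^'n \<Rightarrow> real^'n^'n \<Rightarrow> real^'n \<Rightarrow> real" where
  "BB_alpha H W u = (u \<bullet> (W *v u)) / (u \<bullet> ((W ** H) *v u))"

definition BB_cone :: "real^'n^'n \<Rightarrow> ((real^'n) \<times> (real^'n)) set" where
  "BB_cone H = {(u, v). \<exists>\<alpha>\<in>{inverse (lambda_max H)..inverse (lambda_min H)}.
                          v = (mat 1 - \<alpha> *\<^sub>R H) *v u}"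

text \<open>The only element of \<open>BB_cone H\<close> with \<open>u = 0\<close> is the origin, so there the first branch
  concerns the origin alone. The library norm on the product type is
  \<open>sqrt ((norm u)\<^sup>2 + (norm v)\<^sup>2)\<close>, with the Euclidean norm on each factor.\<close>

definition BB_transition ::
    "real^'n^'n \<Rightarrow> real^'n^'n \<Rightarrow> (real^'n) \<times> (real^'n) \<Rightarrow> (real^'n) \<times> (real^'n)" where
  "BB_transition H W = (\<lambda>(u, v). if u = 0 then (0, 0)
                                 else (v, (mat 1 - BB_alpha H W u *\<^sub>R H) *v v))"

end

theory Submission
  imports Defs
begin

text \<open>Write \<open>a\<close>, \<open>b\<close> for the extreme eigenvalues of \<open>H\<close>, \<open>I\<close> for the interval
  \<open>[1/b, 1/a]\<close>, and \<open>P\<^sub>l\<close> for the orthogonal projection onto the eigenspace of \<open>l\<close>.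
  Everything rests on one estimate: for \<open>u \<noteq> 0\<close> the denominator of \<open>BB_alpha H W u\<close> is
  positive and the quotient lies in \<open>I\<close> (\<open>BB_alpha_bounds\<close>).  For \<open>W = \<omega>(H)\<close> the two quadratic
  forms in the quotient are \<open>\<Sum> \<omega>(l) |P\<^sub>l u|\<^sup>2\<close> and \<open>\<Sum> l \<omega>(l) |P\<^sub>l u|\<^sup>2\<close>, sums over
  the spectrum with nonnegative terms, so that \<open>a \<le> l \<le> b\<close> can be applied term by term.  The first
  sum does not vanish for \<open>u \<noteq> 0\<close>, because a vector orthogonal to all eigenspaces is zero: this is
  the substance of the spectral theorem (\<open>eigenspaces_total\<close>), and it is obtained here by
  maximizing the Rayleigh quotient on an invariant subspace.

  Given the estimate, the cone is invariant because the new pair is again of the form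
  \<open>(v, (I - \<alpha> H) v)\<close> with \<open>\<alpha>\<close> in \<open>I\<close>.  It is closed because \<open>I\<close> is compact: the cone is the
  projection along \<open>I\<close> of a closed set of triples \<open>(\<alpha>, u, v)\<close>.  Homogeneity holds since
  \<open>BB_alpha\<close> does not change when \<open>u\<close> is scaled.  Where \<open>u \<noteq> 0\<close>, the transition is a
  composition of continuous maps.  At the origin \<open>BB_alpha\<close> has no limit in general, but it stays bounded,
  which gives \<open>|T z| \<le> C |z|\<close> and hence continuity there; and the origin is the only point of the
  cone with \<open>u = 0\<close>.\<close>

section \<open>Symmetric matrices and their eigenspaces\<close>

lemma symmetric_matrix_inner:
  fixes H :: "real^'n^'n"
  assumes "transpose H = H"
  shows "x \<bullet> (H *v y) = (H *v x) \<bullet> y"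
  by (metis assms dot_lmul_matrix transpose_matrix_vector)

lemma mat_one_minus_scaleR_mult_vec:
  fixes H :: "real^'n^'n"
  shows "(mat 1 - \<alpha> *\<^sub>R H) *v u = u - \<alpha> *\<^sub>R (H *v u)"
  by (simp add: matrix_vector_mult_diff_rdistrib scaleR_matrix_vector_assoc)

lemma sum_matrix_vector_mult:
  fixes A :: "'a \<Rightarrow> real^'n^'m"
  shows "(\<Sum>i\<in>I. A i) *v x = (\<Sum>i\<in>I. A i *v x)"
  by (induction I rule: infinite_finite_induct) (auto simp: matrix_vector_mult_add_rdistrib)

lemma continuous_on_matrix_vector_mult:
  fixes A :: "real^'n^'m"
  assumes "continuous_on S g"
  shows "continuous_on S (\<lambda>p. A *v g p)"
  by (rule continuous_on_compose2[OF matrix_vector_mult_linear_continuous_on[of UNIV] assms]) simp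

lemma subspace_eigenspace: "subspace (eigenspace H l)"
  by (auto simp: subspace_def eigenspace_def matrix_vector_right_distrib
      matrix_vector_mult_scaleR scaleR_right_distrib)

text \<open>A maximizer of the Rayleigh quotient on the invariant subspace is an eigenvector, by
  first-order optimality: the residual \<open>\<mu> x - H x\<close> lies in the subspace again, so if it were not
  zero, a small step against it would make the nonnegative form \<open>\<mu> |y|\<^sup>2 - y \<bullet> H y\<close> negative.\<close>

lemma invariant_subspace_has_eigenvector:
  fixes H :: "real^'n^'n"
  assumes sym: "transpose H = H" and M: "subspace M"
    and inv: "\<And>x. x \<in> M \<Longrightarrow> H *v x \<in> M" and ne: "M \<noteq> {0}"
  obtains x l where "x \<in> M" "x \<noteq> 0" "x \<in> eigenspace H l"
proof -
  let ?S = "sphere 0 1 \<inter> M"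
  obtain z where z: "z \<in> M" "z \<noteq> 0" using ne M subspace_0 by blast
  have "z /\<^sub>R norm z \<in> ?S" using z M by (auto simp: subspace_scale)
  moreover have "compact ?S" by (intro compact_Int_closed closed_subspace M) auto
  moreover have "continuous_on ?S (\<lambda>x. x \<bullet> (H *v x))"
    by (intro continuous_intros)
  ultimately obtain x where x: "x \<in> ?S" "\<And>y. y \<in> ?S \<Longrightarrow> y \<bullet> (H *v y) \<le> x \<bullet> (H *v x)"
    using continuous_attains_sup[of ?S "\<lambda>x. x \<bullet> (H *v x)"] by blast
  define \<mu> where "\<mu> = x \<bullet> (H *v x)"
  have le: "y \<bullet> (H *v y) \<le> \<mu> * (y \<bullet> y)" if "y \<in> M" for y
  proof (cases "y = 0")
    case False
    have "y /\<^sub>R norm y \<in> ?S" using that False M by (auto simp: subspace_scale)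
    from x(2)[OF this] have "(y \<bullet> (H *v y)) / (norm y * norm y) \<le> \<mu>"
      by (simp add: \<mu>_def matrix_vector_mult_scaleR divide_simps)
    then show ?thesis using False
      by (simp add: divide_simps dot_square_norm power2_eq_square mult.commute)
  qed simp
  define r where "r = \<mu> *\<^sub>R x - H *v x"
  define q where "q = \<mu> * (r \<bullet> r) - r \<bullet> (H *v r)"
  have xM: "x \<in> M" and xx: "x \<bullet> x = 1" using x(1) by (auto simp: dot_square_norm)
  have rM: "r \<in> M" using M inv xM by (simp add: r_def subspace_diff subspace_scale)
  have q0: "q \<ge> 0" using le[OF rM] by (simp add: q_def)
  \<comment> \<open>Along \<open>x + t r\<close> the form is \<open>2 t (r \<bullet> r) + t\<^sup>2 q\<close>. Its minimizer is \<open>- (r \<bullet> r) / q\<close>;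
     the \<open>+ 1\<close> covers \<open>q = 0\<close> and still leaves a negative value.\<close>
  define t where "t = - (r \<bullet> r) / (q + 1)"
  have "0 \<le> \<mu> * ((x + t *\<^sub>R r) \<bullet> (x + t *\<^sub>R r)) - (x + t *\<^sub>R r) \<bullet> (H *v (x + t *\<^sub>R r))"
    using le[of "x + t *\<^sub>R r"] xM rM M by (simp add: subspace_add subspace_scale)
  also have "\<dots> = 2 * t * (r \<bullet> r) + t\<^sup>2 * q"
  proof -
    have "x \<bullet> (H *v r) = (H *v x) \<bullet> r" by (rule symmetric_matrix_inner[OF sym])
    moreover have "(H *v x) \<bullet> r = r \<bullet> (H *v x)" by (rule inner_commute)
    moreover have "r \<bullet> r = \<mu> * (r \<bullet> x) - r \<bullet> (H *v x)"
      by (subst (2) r_def) (simp add: inner_diff_right)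
    ultimately show ?thesis
      by (simp add: inner_add_left inner_add_right matrix_vector_right_distrib
          matrix_vector_mult_scaleR xx \<mu>_def[symmetric] q_def inner_commute[of x r])
        (simp add: algebra_simps power2_eq_square)
  qed
  finally have "0 \<le> 2 * t * (r \<bullet> r) + t\<^sup>2 * q" .
  also have "\<dots> = - (r \<bullet> r)\<^sup>2 * (q + 2) / (q + 1)\<^sup>2"
    using q0 by (simp add: t_def field_simps power2_eq_square add_nonneg_eq_0_iff)
  finally have "(r \<bullet> r)\<^sup>2 * (q + 2) / (q + 1)\<^sup>2 \<le> 0" by simp
  then have "r = 0"
    using q0 by (auto simp: divide_le_0_iff mult_le_0_iff)
  then have "x \<in> eigenspace H \<mu>" by (simp add: r_def eigenspace_def)
  then show thesis using that[of x \<mu>] xM xx by force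
qed

lemma eigenspaces_orthogonal:
  fixes H :: "real^'n^'n"
  assumes sym: "transpose H = H" and "x \<in> eigenspace H l" "y \<in> eigenspace H m" "l \<noteq> m"
  shows "x \<bullet> y = 0"
  using symmetric_matrix_inner[OF sym, of x y] assms by (simp add: eigenspace_def)

text \<open>The orthogonal complement of all eigenspaces is an invariant subspace. If it were nontrivial, it
  would contain an eigenvector, which would then be orthogonal to itself.\<close>

lemma eigenspaces_total:
  fixes H :: "real^'n^'n"
  assumes sym: "transpose H = H"
    and orth: "\<And>l x. x \<in> eigenspace H l \<Longrightarrow> u \<bullet> x = 0"
  shows "u = 0"
proof -
  let ?M = "{y. \<forall>l. \<forall>x\<in>eigenspace H l. y \<bullet> x = 0}"
  have "?M = {0}"
  proof (rule ccontr)
    assume ne: "?M \<noteq> {0}"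
    have M: "subspace ?M" by (auto simp: subspace_def inner_add_left)
    have inv: "H *v y \<in> ?M" if y: "y \<in> ?M" for y
    proof clarify
      fix l x
      assume x: "x \<in> eigenspace H l"
      have "(H *v y) \<bullet> x = y \<bullet> (H *v x)" by (rule symmetric_matrix_inner[OF sym, symmetric])
      also have "\<dots> = l * (y \<bullet> x)" using x by (simp add: eigenspace_def)
      also have "y \<bullet> x = 0" using x y by blast
      finally show "(H *v y) \<bullet> x = 0" by simp
    qed
    obtain x l where "x \<in> ?M" "x \<noteq> 0" "x \<in> eigenspace H l"
      by (rule invariant_subspace_has_eigenvector[OF sym M inv ne])
    then have "x \<bullet> x = 0" by blast
    with \<open>x \<noteq> 0\<close> show False by simp
  qed
  then show ?thesis using orth by blast
qed

lemma spectrum_nonempty: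
  fixes H :: "real^'n^'n"
  assumes sym: "transpose H = H"
  shows "spectrum H \<noteq> {}"
proof -
  have "(UNIV :: (real^'n) set) \<noteq> {0}"
    using UNIV_not_singleton by blast
  then obtain x l where "x \<noteq> 0" "x \<in> eigenspace H l"
    using invariant_subspace_has_eigenvector[OF sym, of UNIV] by auto
  then show ?thesis by (auto simp: spectrum_def)
qed

text \<open>Eigenvectors chosen for distinct eigenvalues are orthogonal, hence linearly independent, so there
  are at most as many eigenvalues as the dimension allows.\<close>

lemma finite_spectrum:
  fixes H :: "real^'n^'n"
  assumes sym: "transpose H = H"
  shows "finite (spectrum H)"
proof -
  obtain f where f: "\<And>l. l \<in> spectrum H \<Longrightarrow> f l \<noteq> 0 \<and> f l \<in> eigenspace H l"
    using bchoice[of "spectrum H" "\<lambda>l x. x \<noteq> 0 \<and> x \<in> eigenspace H l"]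
    by (auto simp: spectrum_def)
  have orth: "f l \<bullet> f m = 0" if "l \<in> spectrum H" "m \<in> spectrum H" "l \<noteq> m" for l m
    using eigenspaces_orthogonal[OF sym] f that by blast
  have inj: "inj_on f (spectrum H)"
    by (rule inj_onI) (metis f inner_eq_zero_iff orth)
  have "pairwise orthogonal (f ` spectrum H)"
    unfolding pairwise_def orthogonal_def using orth by blast
  moreover have "0 \<notin> f ` spectrum H" using f by force
  ultimately have "finite (f ` spectrum H)"
    by (intro independent_imp_finite pairwise_orthogonal_independent)
  then show ?thesis using inj by (rule finite_imageD)
qed

lemma spectrum_bounds:
  fixes H :: "real^'n^'n"
  assumes sym: "transpose H = H" and "l \<in> spectrum H"
  shows "lambda_min H \<le> l" "l \<le> lambda_max H"
  using assms finite_spectrum[OF sym] by (simp_all add: lambda_min_def lambda_max_def)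

lemma spectrum_pos:
  fixes H :: "real^'n^'n"
  assumes "sym_pos_def H" "l \<in> spectrum H"
  shows "l > 0"
proof -
  obtain x where x: "x \<noteq> 0" "H *v x = l *\<^sub>R x"
    using assms by (auto simp: spectrum_def eigenspace_def)
  with assms(1) have "0 < l * (x \<bullet> x)" by (metis inner_scaleR_right sym_pos_def_def)
  then show ?thesis by (rule zero_less_mult_pos2) (use x(1) in simp)
qed

lemma lambda_min_pos:
  fixes H :: "real^'n^'n"
  assumes "sym_pos_def H"
  shows "lambda_min H > 0"
  using assms spectrum_pos Min_in[OF finite_spectrum spectrum_nonempty]
  by (auto simp: lambda_min_def sym_pos_def_def)

lemma lambda_min_le_lambda_max:
  fixes H :: "real^'n^'n"
  assumes "transpose H = H"
  shows "lambda_min H \<le> lambda_max H"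
  using spectrum_bounds[OF assms] spectrum_nonempty[OF assms] by force

section \<open>Nearest-point maps of subspaces as orthogonal projections\<close>

lemma closest_point_subspace_mem:
  fixes S :: "'a::euclidean_space set"
  assumes "subspace S"
  shows "closest_point S x \<in> S"
  using closest_point_in_set[OF closed_subspace] assms subspace_0 by blast

text \<open>The variational inequality for nearest points of convex sets becomes an equality on a subspace,
  since both \<open>y\<close> and \<open>- y\<close> are admissible directions.\<close>

lemma closest_point_subspace_residual:
  fixes S :: "'a::euclidean_space set"
  assumes S: "subspace S" and y: "y \<in> S"
  shows "(x - closest_point S x) \<bullet> y = 0"
proof -
  let ?p = "closest_point S x"
  have p: "?p \<in> S" by (rule closest_point_subspace_mem[OF S])
  have "(x - ?p) \<bullet> z \<le> 0" if "z \<in> S" for z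
    using closest_point_dot[OF subspace_imp_convex[OF S] closed_subspace[OF S], of "?p + z" x]
      subspace_add[OF S p that] by simp
  from this[OF y] this[OF subspace_neg[OF S y]] show ?thesis by simp
qed

lemma closest_point_subspace_unique:
  fixes S :: "'a::euclidean_space set"
  assumes S: "subspace S" and z: "z \<in> S" and orth: "\<And>y. y \<in> S \<Longrightarrow> (x - z) \<bullet> y = 0"
  shows "closest_point S x = z"
proof -
  let ?d = "z - closest_point S x"
  have "?d \<in> S" using S z by (simp add: closest_point_subspace_mem subspace_diff)
  then have "(x - closest_point S x) \<bullet> ?d - (x - z) \<bullet> ?d = 0"
    using orth closest_point_subspace_residual[OF S] by simp
  then have "?d \<bullet> ?d = 0" by (simp add: inner_diff_left)
  then show ?thesis by simp
qed

lemma linear_closest_point: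
  fixes S :: "'a::euclidean_space set"
  assumes S: "subspace S"
  shows "linear (closest_point S)"
proof (rule linearI)
  note orth = closest_point_subspace_residual[OF S]
  fix x y :: 'a and c :: real
  show "closest_point S (x + y) = closest_point S x + closest_point S y"
  proof (rule closest_point_subspace_unique[OF S])
    fix z assume "z \<in> S"
    then show "(x + y - (closest_point S x + closest_point S y)) \<bullet> z = 0"
      using orth[of z x] orth[of z y] by (simp add: algebra_simps inner_diff_left inner_add_left)
  qed (simp add: S closest_point_subspace_mem subspace_add)
  show "closest_point S (c *\<^sub>R x) = c *\<^sub>R closest_point S x"
  proof (rule closest_point_subspace_unique[OF S])
    fix z assume "z \<in> S"
    then show "(c *\<^sub>R x - c *\<^sub>R closest_point S x) \<bullet> z = 0"
      using orth[of z x] by (simp add: scaleR_right_diff_distrib[symmetric])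
  qed (simp add: S closest_point_subspace_mem subspace_scale)
qed

lemma inner_closest_point:
  fixes S :: "'a::euclidean_space set"
  assumes S: "subspace S"
  shows "u \<bullet> closest_point S x = closest_point S u \<bullet> closest_point S x"
  using closest_point_subspace_residual[OF S closest_point_subspace_mem[OF S], of u x]
  by (simp add: inner_diff_left)

section \<open>Quadratic forms of spectral weights\<close>

lemma functional_calculus_mult_vec:
  fixes H :: "real^'n^'n"
  shows "functional_calculus \<omega> H *v x =
    (\<Sum>l\<in>spectrum H. \<omega> l *\<^sub>R closest_point (eigenspace H l) x)"
proof -
  have "matrix (closest_point (eigenspace H l)) *v x = closest_point (eigenspace H l) x" for l
    using matrix_vector_mul(2)[OF linear_closest_point[OF subspace_eigenspace]] by metis
  then show ?thesis
    by (simp add: functional_calculus_def sum_matrix_vector_mult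
        scaleR_matrix_vector_assoc[symmetric])
qed

lemma functional_calculus_quadratic_form:
  fixes H :: "real^'n^'n"
  shows "u \<bullet> (functional_calculus \<omega> H *v u) =
    (\<Sum>l\<in>spectrum H. \<omega> l * (norm (closest_point (eigenspace H l) u))\<^sup>2)"
  by (simp add: functional_calculus_mult_vec inner_sum_right dot_square_norm
      inner_closest_point[OF subspace_eigenspace, of u])

text \<open>Multiplication by \<open>H\<close> contributes the factor \<open>l\<close> because \<open>P\<^sub>l\<close> is self-adjoint and \<open>H\<close> acts as
  \<open>l\<close> on its range: \<open>u \<bullet> P\<^sub>l (H u) = (H (P\<^sub>l u)) \<bullet> u = l (P\<^sub>l u \<bullet> u)\<close>.\<close>

lemma functional_calculus_mult_quadratic_form:
  fixes H :: "real^'n^'n"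
  assumes sym: "transpose H = H"
  shows "u \<bullet> ((functional_calculus \<omega> H ** H) *v u) =
    (\<Sum>l\<in>spectrum H. l * (\<omega> l * (norm (closest_point (eigenspace H l) u))\<^sup>2))"
proof -
  have "u \<bullet> closest_point (eigenspace H l) (H *v u)
      = l * (norm (closest_point (eigenspace H l) u))\<^sup>2" for l
  proof -
    let ?P = "closest_point (eigenspace H l)"
    have "?P u \<in> eigenspace H l"
      by (rule closest_point_subspace_mem[OF subspace_eigenspace])
    then have HP: "H *v ?P u = l *\<^sub>R ?P u" by (simp add: eigenspace_def)
    have "u \<bullet> ?P (H *v u) = ?P u \<bullet> (H *v u)"
      by (metis inner_closest_point[OF subspace_eigenspace] inner_commute)
    also have "\<dots> = l * (?P u \<bullet> u)"
      by (simp add: symmetric_matrix_inner[OF sym] HP)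
    also have "?P u \<bullet> u = (norm (?P u))\<^sup>2"
      by (metis inner_closest_point[OF subspace_eigenspace] inner_commute dot_square_norm)
    finally show ?thesis .
  qed
  then show ?thesis
    by (simp add: matrix_vector_mul_assoc[symmetric] functional_calculus_mult_vec
        inner_sum_right mult.left_commute)
qed

text \<open>By completeness of the eigenspaces some \<open>P\<^sub>l u\<close> is nonzero, and it gives a positive term.\<close>

lemma positive_spectral_weight_form_pos:
  fixes H :: "real^'n^'n"
  assumes sym: "transpose H = H" and W: "positive_spectral_weight H W" and u: "u \<noteq> 0"
  shows "u \<bullet> (W *v u) > 0"
proof -
  obtain \<omega> where \<omega>: "\<And>l. l \<in> spectrum H \<Longrightarrow> \<omega> l > 0" and W_eq: "W = functional_calculus \<omega> H"
    using W by (auto simp: positive_spectral_weight_def)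
  obtain l x where x: "x \<in> eigenspace H l" "u \<bullet> x \<noteq> 0"
    using eigenspaces_total[OF sym] u by blast
  then have "x \<noteq> 0" by auto
  with x(1) have l: "l \<in> spectrum H" by (auto simp: spectrum_def)
  have "closest_point (eigenspace H l) u \<noteq> 0"
    using closest_point_subspace_residual[OF subspace_eigenspace x(1), of u] x(2) by auto
  then have "0 < \<omega> l * (norm (closest_point (eigenspace H l) u))\<^sup>2"
    using \<omega>[OF l] by simp
  then show ?thesis
    unfolding W_eq functional_calculus_quadratic_form
    using l \<omega> finite_spectrum[OF sym] by (intro sum_pos2) (auto simp: less_imp_le)
qed

lemma positive_spectral_weight_form_bounds:
  fixes H :: "real^'n^'n"
  assumes sym: "transpose H = H" and W: "positive_spectral_weight H W"
  shows "lambda_min H * (u \<bullet> (W *v u)) \<le> u \<bullet> ((W ** H) *v u)"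
    and "u \<bullet> ((W ** H) *v u) \<le> lambda_max H * (u \<bullet> (W *v u))"
proof -
  obtain \<omega> where \<omega>: "\<And>l. l \<in> spectrum H \<Longrightarrow> \<omega> l > 0" and W_eq: "W = functional_calculus \<omega> H"
    using W by (auto simp: positive_spectral_weight_def)
  show "lambda_min H * (u \<bullet> (W *v u)) \<le> u \<bullet> ((W ** H) *v u)"
    "u \<bullet> ((W ** H) *v u) \<le> lambda_max H * (u \<bullet> (W *v u))"
    unfolding W_eq functional_calculus_quadratic_form
      functional_calculus_mult_quadratic_form[OF sym] sum_distrib_left
    using \<omega> spectrum_bounds[OF sym]
    by (auto intro!: sum_mono mult_right_mono simp: less_imp_le)
qed

section \<open>The step length, the compatible cone and the transition\<close>

lemma BB_alpha_bounds:
  fixes H :: "real^'n^'n"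
  assumes H: "sym_pos_def H" and W: "positive_spectral_weight H W" and u: "u \<noteq> 0"
  shows "u \<bullet> ((W ** H) *v u) > 0"
    and "BB_alpha H W u \<in> {inverse (lambda_max H)..inverse (lambda_min H)}"
proof -
  have sym: "transpose H = H" using H by (simp add: sym_pos_def_def)
  note bounds = positive_spectral_weight_form_bounds[OF sym W, of u]
  have a: "lambda_min H > 0" by (rule lambda_min_pos[OF H])
  have b: "lambda_max H > 0" using a lambda_min_le_lambda_max[OF sym] by linarith
  have w: "u \<bullet> (W *v u) > 0" by (rule positive_spectral_weight_form_pos[OF sym W u])
  show pos: "u \<bullet> ((W ** H) *v u) > 0"
    using bounds(1) mult_pos_pos[OF a w] by linarith
  show "BB_alpha H W u \<in> {inverse (lambda_max H)..inverse (lambda_min H)}"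
    using bounds a b pos by (simp add: BB_alpha_def field_simps)
qed

lemma mem_BB_cone:
  "(u, v) \<in> BB_cone H \<longleftrightarrow>
    (\<exists>\<alpha>\<in>{inverse (lambda_max H)..inverse (lambda_min H)}. v = u - \<alpha> *\<^sub>R (H *v u))"
  by (simp add: BB_cone_def mat_one_minus_scaleR_mult_vec)

lemma zero_mem_BB_cone:
  fixes H :: "real^'n^'n"
  assumes "sym_pos_def H"
  shows "(0, 0) \<in> BB_cone H"
  using lambda_min_pos[OF assms] lambda_min_le_lambda_max[of H] assms
  by (auto simp: mem_BB_cone sym_pos_def_def intro!: bexI[of _ "inverse (lambda_min H)"] le_imp_inverse_le)

lemma closed_cone_BB_cone:
  fixes H :: "real^'n^'n"
  assumes "sym_pos_def H"
  shows "closed_cone (BB_cone H)"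
  unfolding closed_cone_def
proof (intro conjI)
  let ?I = "{inverse (lambda_max H)..inverse (lambda_min H)}"
  \<comment> \<open>The triples \<open>(\<alpha>, u, v)\<close> with \<open>v = (I - \<alpha> H) u\<close>; projecting out \<open>\<alpha>\<close> in the compact
     interval keeps the set closed.\<close>
  let ?T = "{p :: real \<times> (real^'n) \<times> (real^'n).
              snd (snd p) = fst (snd p) - fst p *\<^sub>R (H *v fst (snd p))}"
  have "closed ?T"
    by (intro closed_Collect_eq continuous_intros continuous_on_matrix_vector_mult)
  then have "closed {y. \<exists>\<alpha>. \<alpha> \<in> ?I \<and> (\<alpha>, y) \<in> ?T}"
    by (intro closed_compact_projection) auto
  also have "{y. \<exists>\<alpha>. \<alpha> \<in> ?I \<and> (\<alpha>, y) \<in> ?T} = BB_cone H"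
    unfolding BB_cone_def mat_one_minus_scaleR_mult_vec Bex_def by auto
  finally show "closed (BB_cone H)" .
  show "cone (BB_cone H)"
    unfolding cone_def
  proof clarify
    fix u v :: "real^'n" and c :: real
    assume "(u, v) \<in> BB_cone H"
    then obtain \<alpha> where "\<alpha> \<in> ?I" "v = u - \<alpha> *\<^sub>R (H *v u)"
      unfolding mem_BB_cone by blast
    moreover from this have "c *\<^sub>R v = c *\<^sub>R u - \<alpha> *\<^sub>R (H *v (c *\<^sub>R u))"
      by (simp add: matrix_vector_mult_scaleR scaleR_right_diff_distrib mult.commute)
    ultimately show "c *\<^sub>R (u, v) \<in> BB_cone H"
      unfolding scaleR_Pair mem_BB_cone by blast
  qed
  show "0 \<in> BB_cone H" "BB_cone H \<noteq> {}"
    using zero_mem_BB_cone[OF assms] by (auto simp: zero_prod_def)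
qed

lemma BB_transition_nonzero:
  "u \<noteq> 0 \<Longrightarrow> BB_transition H W (u, v) = (v, v - BB_alpha H W u *\<^sub>R (H *v v))"
  by (simp add: BB_transition_def mat_one_minus_scaleR_mult_vec)

lemma BB_transition_zero: "BB_transition H W (0, v) = (0, 0)"
  by (simp add: BB_transition_def)

lemma BB_transition_maps_cone:
  fixes H :: "real^'n^'n"
  assumes H: "sym_pos_def H" and W: "positive_spectral_weight H W"
  shows "BB_transition H W ` BB_cone H \<subseteq> BB_cone H"
proof (rule image_subsetI)
  fix z :: "(real^'n) \<times> (real^'n)"
  obtain u v where uv: "z = (u, v)" by (cases z)
  show "BB_transition H W z \<in> BB_cone H"
  proof (cases "u = 0")
    case True
    then show ?thesis by (simp add: uv BB_transition_zero zero_mem_BB_cone[OF H])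
  next
    case False
    then show ?thesis
      using BB_alpha_bounds(2)[OF H W False]
      unfolding uv BB_transition_nonzero[OF False] mem_BB_cone by blast
  qed
qed

lemma BB_alpha_scale:
  assumes "t \<noteq> 0"
  shows "BB_alpha H W (t *\<^sub>R u) = BB_alpha H W u"
  using assms by (simp add: BB_alpha_def matrix_vector_mult_scaleR)

text \<open>The step length depends only on the line spanned by \<open>u\<close>, so for \<open>u \<noteq> 0\<close> and \<open>t \<noteq> 0\<close> it is the
  same on both sides; if \<open>u = 0\<close> or \<open>t = 0\<close>, both sides vanish.\<close>

lemma BB_transition_homogeneous:
  "BB_transition H W (t *\<^sub>R z) = t *\<^sub>R BB_transition H W z"
proof (cases z)
  case (Pair u v)
  show ?thesis
  proof (cases "t = 0 \<or> u = 0")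
    case True
    then show ?thesis
      by (auto simp: Pair BB_transition_zero zero_prod_def)
  next
    case False
    then show ?thesis
      by (simp add: Pair BB_transition_nonzero BB_alpha_scale matrix_vector_mult_scaleR
          scaleR_right_diff_distrib mult.commute)
  qed
qed

text \<open>Linear growth is what yields continuity at the origin, where the step length itself has no
  limit in general.\<close>

lemma BB_transition_norm_bound:
  fixes H :: "real^'n^'n"
  assumes H: "sym_pos_def H" and W: "positive_spectral_weight H W"
  obtains C where "\<And>z. norm (BB_transition H W z) \<le> C * norm z"
proof -
  obtain K where K: "K > 0" "\<And>x. norm (H *v x) \<le> norm x * K"
    using bounded_linear.pos_bounded[OF matrix_vector_mul_bounded_linear[of H]] by blast
  let ?c = "inverse (lambda_min H)"
  have a: "lambda_min H > 0" by (rule lambda_min_pos[OF H])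
  have "norm (BB_transition H W (u, v)) \<le> (2 + ?c * K) * norm (u, v)" for u v
  proof (cases "u = 0")
    case True
    have "0 \<le> (2 + ?c * K) * norm (u, v)"
      using a K(1) by (intro mult_nonneg_nonneg) auto
    then show ?thesis by (simp add: True BB_transition_zero)
  next
    case False
    have sym: "transpose H = H" using H by (simp add: sym_pos_def_def)
    have "0 < inverse (lambda_max H)" using a lambda_min_le_lambda_max[OF sym] by simp
    then have \<alpha>: "\<bar>BB_alpha H W u\<bar> \<le> ?c"
      using BB_alpha_bounds(2)[OF H W False] unfolding atLeastAtMost_iff by linarith
    have "norm (BB_transition H W (u, v))
        \<le> norm v + norm (v - BB_alpha H W u *\<^sub>R (H *v v))"
      unfolding BB_transition_nonzero[OF False] by (rule norm_Pair_le)
    also have "\<dots> \<le> norm v + (norm v + \<bar>BB_alpha H W u\<bar> * norm (H *v v))"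
      by (metis add_left_mono norm_scaleR norm_triangle_ineq4)
    also have "\<dots> \<le> norm v + (norm v + ?c * (norm v * K))"
      using \<alpha> K a by (intro add_left_mono mult_mono) auto
    also have "\<dots> = (2 + ?c * K) * norm v" by (simp add: algebra_simps)
    also have "\<dots> \<le> (2 + ?c * K) * norm (u, v)"
      using a K(1) norm_snd_le[of v u] by (intro mult_left_mono) auto
    finally show ?thesis .
  qed
  then show thesis by (intro that[of "2 + ?c * K"]) auto
qed

lemma continuous_on_BB_transition:
  fixes H :: "real^'n^'n"
  assumes H: "sym_pos_def H" and W: "positive_spectral_weight H W"
  shows "continuous_on (BB_cone H) (BB_transition H W)"
  unfolding continuous_on_eq_continuous_within
proof
  fix z assume z: "z \<in> BB_cone H"
  obtain u v where uv: "z = (u, v)" by (cases z)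
  show "continuous (at z within BB_cone H) (BB_transition H W)"
  proof (cases "u = 0")
    case True
    with z have z0: "z = 0" by (auto simp: uv mem_BB_cone zero_prod_def)
    obtain C where C: "\<And>z. norm (BB_transition H W z) \<le> C * norm z"
      using BB_transition_norm_bound[OF H W] by blast
    have "((\<lambda>z. C * norm z) \<longlongrightarrow> C * norm (0 :: (real^'n) \<times> (real^'n)))
        (at 0 within BB_cone H)"
      by (intro tendsto_intros)
    then have "((\<lambda>z. C * norm z) \<longlongrightarrow> 0) (at 0 within BB_cone H)" by simp
    then have "(BB_transition H W \<longlongrightarrow> 0) (at 0 within BB_cone H)"
      by (rule Lim_null_comparison[rotated]) (simp add: C)
    moreover have "BB_transition H W 0 = 0" by (simp add: zero_prod_def BB_transition_zero)
    ultimately show ?thesis by (simp add: continuous_within z0)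
  next
    case False
    \<comment> \<open>The case distinction in the transition is constant near \<open>z\<close>, as \<open>?U\<close> is open.\<close>
    let ?U = "{p :: (real^'n) \<times> (real^'n). fst p \<noteq> 0}"
    let ?f = "\<lambda>p. (snd p, snd p - BB_alpha H W (fst p) *\<^sub>R (H *v snd p))"
    have U: "open ?U" by (intro open_Collect_neq continuous_intros)
    have nz: "fst p \<bullet> ((W ** H) *v fst p) \<noteq> 0" if "p \<in> ?U" for p
      using BB_alpha_bounds(1)[OF H W, of "fst p"] that by simp
    have "continuous_on ?U ?f"
      unfolding BB_alpha_def using nz by (intro continuous_intros continuous_on_matrix_vector_mult) auto
    then have "continuous_on ?U (BB_transition H W)"
      by (rule continuous_on_eq) (auto simp: BB_transition_nonzero)
    then have "continuous (at z) (BB_transition H W)"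
      using U False uv by (simp add: continuous_on_eq_continuous_at)
    then show ?thesis by (rule continuous_at_imp_continuous_within)
  qed
qed

theorem proposition3p1:
  fixes H :: "real^'n^'n"
  assumes "sym_pos_def H"
  shows "closed_cone (BB_cone H) \<and>
    (\<forall>W. positive_spectral_weight H W \<longrightarrow>
       BB_transition H W ` BB_cone H \<subseteq> BB_cone H \<and>
       continuous_on (BB_cone H) (BB_transition H W) \<and>
       (\<forall>t\<ge>0. \<forall>z\<in>BB_cone H. BB_transition H W (t *\<^sub>R z) = t *\<^sub>R BB_transition H W z))"
  using closed_cone_BB_cone[OF assms] BB_transition_maps_cone[OF assms]
    continuous_on_BB_transition[OF assms] BB_transition_homogeneous
  by blast

end
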